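(* Let $C_{\mathrm{post}}\in\mathbb{R}^{d\times d}$ be the posterior covariance, with eigendecomposition $C_{\mathrm{post}}v_i=\lambda_i v_i$, $i=1,\dots,d$, where $\{v_i\}_{i=1}^d$ is an orthonormal basis of $\mathbb{R}^d$ and $\lambda_i>0$. Let $T>0$, let $\boldsymbol z_T$ be the $\{0,1\}^N$-valued random variable obtained by measuring the early-terminated state $\psi(T)$ in the computational basis, put $\boldsymbol x_T=B\boldsymbol z_T$ with $B\in\mathbb{R}^{d\times N}$ the encoding matrix, and for each $i$ put $S_T^i:=v_i^\top(\boldsymbol x_T-\boldsymbol x_{\mathrm{MAP}})$. Assume that the adiabatic failure probability $p_T:=\mathbb{P}(\boldsymbol z_T\neq \boldsymbol z^\star)$ satisfies $p_T\le K/(T^2\gamma^4)$ for a constant $K>0$, and that the excess energy is bounded by $E_{\max}$, i.e. $E(\boldsymbol z)-E(\boldsymbol z^\star)\le E_{\max}$ for all $\boldsymbol z\in\{0,1\}^N$. Then, with $C'=2E_{\max}K$, for every $i=1,\dots,d$, $$\operatorname{Var}(S_T^i)\le C'\,\frac{\lambda_i}{T^2\gamma^4},$$ and moreover $$\operatorname{Tr}(\operatorname{Cov}(\boldsymbol x_T))\le C'\,\frac{\operatorname{Tr}(C_{\mathrm{post}})}{T^2\gamma^4}.$$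
   Context: Inverse problem and posterior. Let $A$ be a real matrix (forward operator) with $n$ columns, $g$ a real data vector, $\Phi\in\mathbb{R}^{n\times d}$ a synthesis matrix and $\alpha>0$. Set $$C_{\mathrm{post}}=(\Phi^\top A^\top A\Phi+\alpha I)^{-1},\qquad \boldsymbol x_{\mathrm{MAP}}=C_{\mathrm{post}}\Phi^\top A^\top g,$$ where $\Phi^\top A^\top A\Phi+\alpha I$ is strictly positive definite, so $C_{\mathrm{post}}$ is symmetric positive definite. The posterior density on $\mathbb{R}^d$ is proportional to $\exp\left(-\tfrac12(\boldsymbol x-\boldsymbol x_{\mathrm{MAP}})^\top C_{\mathrm{post}}^{-1}(\boldsymbol x-\boldsymbol x_{\mathrm{MAP}})\right)$. Binary encoding and energy. A matrix $B\in\mathbb{R}^{d\times N}$ encodes binary vectors $\boldsymbol z\in\{0,1\}^N$ as candidate solutions $\boldsymbol x(\boldsymbol z)=B\boldsymbol z\in\mathbb{R}^d$. The energy $E(\boldsymbol z)$ is the negative log-posterior density at $\boldsymbol x(\boldsymbol z)$, up to an additive constant independent of $\boldsymbol z$: $$E(\boldsymbol z)=\tfrac12(B\boldsymbol z-\boldsymbol x_{\mathrm{MAP}})^\top C_{\mathrm{post}}^{-1}(B\boldsymbol z-\boldsymbol x_{\mathrm{MAP}})+\text{const}.$$ The posterior mode is assumed representable: there is $\boldsymbol z^\star\in\{0,1\}^N$ with $B\boldsymbol z^\star=\boldsymbol x_{\mathrm{MAP}}$; then $\boldsymbol z^\star$ minimizes $E$ over $\{0,1\}^N$. Quantum evolution.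 Let $\mathcal V=(\mathbb{C}^2)^{\otimes N}$ with orthonormal computational basis $\{e_{\boldsymbol z}\}_{\boldsymbol z\in\{0,1\}^N}$. Let $\mathcal H_F e_{\boldsymbol z}=E(\boldsymbol z)e_{\boldsymbol z}$ and $\mathcal H_I=-\sum_{i=1}^N X_i$, where $X_i$ acts as $\begin{pmatrix}0&1\\1&0\end{pmatrix}$ on the $i$-th tensor factor and as the identity on the others. Let $\mathcal H(s)=(1-s)\mathcal H_I+s\mathcal H_F$, $s\in[0,1]$. Its smallest eigenvalue is assumed simple for every $s$ and separated from the rest of the spectrum, and $\gamma>0$ denotes the minimum over $s\in[0,1]$ of the gap between the two smallest eigenvalues of $\mathcal H(s)$. The state $\psi(T)\in\mathcal V$ is the unit vector obtained at the end of the evolution with total time $T$: it is the value at $s=1$ of the solution of $i\frac{d}{ds}\psi=T\mathcal H(s)\psi$ on $[0,1]$ started from the normalized ground state of $\mathcal H_I$. Measuring $\psi(T)$ in the computational basis yields $\boldsymbol z_T$ with law $q_T(\boldsymbol z)=\mathbb{P}(\boldsymbol z_T=\boldsymbol z)=|\langle e_{\boldsymbol z},\psi(T)\rangle|^2$. $\operatorname{Var}$ and $\operatorname{Cov}$ denote variance and covariance matrix under this law. *)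

theory Defs
  imports "HOL-Analysis.Analysis" "HOL-Probability.Probability"
begin

definition C_post :: "real^'n^'m \<Rightarrow> real^'d^'n \<Rightarrow> real \<Rightarrow> real^'d^'d" where
  "C_post A \<Phi> \<alpha> = matrix_inv (transpose \<Phi> ** transpose A ** A ** \<Phi> + \<alpha> *\<^sub>R mat 1)"

definition x_MAP :: "real^'n^'m \<Rightarrow> real^'m \<Rightarrow> real^'d^'n \<Rightarrow> real \<Rightarrow> real^'d" where
  "x_MAP A g \<Phi> \<alpha> = (C_post A \<Phi> \<alpha> ** transpose \<Phi> ** transpose A) *v g"

text \<open>Bit strings are elements of \<^typ>\<open>bool^'N\<close>; this is a finite type, so it can itself
  index the coordinates of the state space below.\<close>

definition bits :: "bool^'N \<Rightarrow> real^'N" where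
  "bits z = (\<chi> j. of_bool (z $ j))"

definition encode :: "real^'N^'d \<Rightarrow> bool^'N \<Rightarrow> real^'d" where
  "encode B z = B *v bits z"

text \<open>The argument \<open>c\<close> is the arbitrary additive constant of the negative log-posterior.\<close>

definition energy ::
  "real^'n^'m \<Rightarrow> real^'m \<Rightarrow> real^'d^'n \<Rightarrow> real \<Rightarrow> real^'N^'d \<Rightarrow> real \<Rightarrow> bool^'N \<Rightarrow> real" where
  "energy A g \<Phi> \<alpha> B c z =
     1/2 * ((encode B z - x_MAP A g \<Phi> \<alpha>) \<bullet>
            (matrix_inv (C_post A \<Phi> \<alpha>) *v (encode B z - x_MAP A g \<Phi> \<alpha>))) + c"

text \<open>The space \<open>(\<complex>\<^sup>2)\<^sup>\<otimes>\<^sup>N\<close> is \<^typ>\<open>complex^(bool^'N)\<close>, with the computational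
  basis vector of \<open>z\<close> being \<open>axis z 1\<close>. Identifying \<open>e\<^sub>z\<close> with the product of the one-qubit basis
  vectors indexed by the bits of \<open>z\<close>, a tensor product of one-qubit operators has as entries the
  products of the entries of its factors.\<close>

definition tensor_op :: "('N \<Rightarrow> complex^bool^bool) \<Rightarrow> complex^(bool^'N)^(bool^'N::finite)" where
  "tensor_op M = (\<chi> z w. \<Prod>j\<in>UNIV. M j $ (z $ j) $ (w $ j))"

definition pauli_x :: "complex^bool^bool" where
  "pauli_x = (\<chi> a b. if a = b then 0 else 1)"

definition X_op :: "'N \<Rightarrow> complex^(bool^'N)^(bool^'N::finite)" where
  "X_op i = tensor_op (\<lambda>j. if j = i then pauli_x else mat 1)"

definition H_I :: "complex^(bool^'N)^(bool^'N::finite)" where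
  "H_I = - (\<Sum>i\<in>UNIV. X_op i)"

definition H_F :: "(bool^'N \<Rightarrow> real) \<Rightarrow> complex^(bool^'N)^(bool^'N::finite)" where
  "H_F E = (\<chi> z w. if z = w then complex_of_real (E z) else 0)"

definition Ham :: "(bool^'N \<Rightarrow> real) \<Rightarrow> real \<Rightarrow> complex^(bool^'N)^(bool^'N::finite)" where
  "Ham E s = (1 - s) *\<^sub>R H_I + s *\<^sub>R H_F E"

text \<open>These notions are only used for Hermitian matrices, whose eigenvalues are all real and whose
  geometric and algebraic multiplicities agree.\<close>

definition eigenspace :: "complex^'k^'k \<Rightarrow> real \<Rightarrow> (complex^'k) set" where
  "eigenspace M l = {v. M *v v = complex_of_real l *s v}"

definition eigenvalues :: "complex^'k^'k \<Rightarrow> real set" where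
  "eigenvalues M = {l. \<exists>v \<in> eigenspace M l. v \<noteq> 0}"

definition ground_energy :: "complex^'k^'k \<Rightarrow> real" where
  "ground_energy M = Min (eigenvalues M)"

definition simple_ground :: "complex^'k^'k \<Rightarrow> bool" where
  "simple_ground M \<longleftrightarrow> vec.dim (eigenspace M (ground_energy M)) = 1"

text \<open>Gap between the two smallest eigenvalues, for a matrix of size at least two whose smallest
  eigenvalue is simple.\<close>

definition spectral_gap :: "complex^'k^'k \<Rightarrow> real" where
  "spectral_gap M = Min (eigenvalues M - {ground_energy M}) - ground_energy M"

definition is_minimal_gap :: "(bool^'N::finite \<Rightarrow> real) \<Rightarrow> real \<Rightarrow> bool" where
  "is_minimal_gap E \<gamma> \<longleftrightarrow>
     (\<exists>s\<in>{0..1}. spectral_gap (Ham E s) = \<gamma>) \<and> (\<forall>s\<in>{0..1}. \<gamma> \<le> spectral_gap (Ham E s))"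

text \<open>The normalized ground state is determined up to a phase, which does not affect the
  measurement law; any choice is admitted as initial value.\<close>

definition normalized_ground_state :: "complex^'k^'k \<Rightarrow> complex^'k \<Rightarrow> bool" where
  "normalized_ground_state M v \<longleftrightarrow> v \<in> eigenspace M (ground_energy M) \<and> norm v = 1"

definition adiabatic_evolution ::
  "(bool^'N::finite \<Rightarrow> real) \<Rightarrow> real \<Rightarrow> (real \<Rightarrow> complex^(bool^'N)) \<Rightarrow> bool" where
  "adiabatic_evolution E T \<psi> \<longleftrightarrow>
     normalized_ground_state H_I (\<psi> 0) \<and>
     (\<forall>s\<in>{0..1}. \<exists>D. (\<psi> has_vector_derivative D) (at s within {0..1}) \<and>
                    \<i> *s D = complex_of_real T *s (Ham E s *v \<psi> s))"

definition cinner :: "complex^'k \<Rightarrow> complex^'k \<Rightarrow> complex" where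
  "cinner u v = (\<Sum>k\<in>UNIV. cnj (u $ k) * v $ k)"

definition born_prob :: "complex^'k \<Rightarrow> 'k \<Rightarrow> real" where
  "born_prob \<phi> z = (cmod (cinner (axis z 1) \<phi>))\<^sup>2"

definition covariance_matrix :: "'w measure \<Rightarrow> ('w \<Rightarrow> real^'d) \<Rightarrow> real^'d^'d" where
  "covariance_matrix M X =
     (\<chi> i j. \<integral>\<omega>. (X \<omega> $ i - (\<integral>\<omega>'. X \<omega>' $ i \<partial>M)) * (X \<omega> $ j - (\<integral>\<omega>'. X \<omega>' $ j \<partial>M)) \<partial>M)"

end

theory Submission imports Defs begin

text \<open>The adiabatic theorem enters only through the assumed bound on the failure probability
  \<open>p\<^sub>T = \<P>(z\<^sub>T \<noteq> z\<^sup>\<star>)\<close>; the rest is a comparison of quadratic forms. Write \<open>y(z) = B z - x\<^sub>M\<^sub>A\<^sub>P\<close>. Expanding \<open>y(z)\<close> in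
  the orthonormal eigenbasis of the posterior covariance, the excess energy is
  \<open>E(z) - E(z\<^sup>\<star>) = 1/2 \<Sum>\<^sub>i (v\<^sub>i \<bullet> y(z))\<^sup>2 / \<lambda>\<^sub>i\<close>, so each coordinate obeys
  \<open>(v\<^sub>i \<bullet> y(z))\<^sup>2 \<le> 2 \<lambda>\<^sub>i E\<^sub>m\<^sub>a\<^sub>x\<close> (lemma \<open>inner_eigenvector_power2_le\<close>). This coordinate vanishes
  at \<open>z = z\<^sup>\<star>\<close>, hence its second moment is at most \<open>2 \<lambda>\<^sub>i E\<^sub>m\<^sub>a\<^sub>x p\<^sub>T\<close> (lemma
  \<open>expectation_le_bound_times_prob_neq\<close>), and a variance never exceeds the second moment about
  any point. For the trace, the sum of the variances of the standard coordinates of \<open>x\<^sub>T\<close> is at most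
  the expectation of the squared norm of \<open>y(z\<^sub>T)\<close>, which by Parseval is the sum over \<open>i\<close> of
  the second moments just bounded; and \<open>\<Sum>\<^sub>i \<lambda>\<^sub>i\<close> is the trace of the posterior covariance.\<close>

lemma orthonormal_expansion:
  fixes v :: "'d::finite \<Rightarrow> 'a::euclidean_space"
  assumes orthonormal: "\<And>i j. v i \<bullet> v j = (if i = j then 1 else 0)"
    and basis: "span (range v) = UNIV"
  shows "(\<Sum>i\<in>UNIV. (v i \<bullet> y) *\<^sub>R v i) = y"
proof -
  define r where "r = y - (\<Sum>i\<in>UNIV. (v i \<bullet> y) *\<^sub>R v i)"
  \<comment> \<open>The remainder is orthogonal to a spanning set, hence to itself.\<close>
  have "orthogonal r (v j)" for j
    by (simp add: r_def orthogonal_def inner_diff_left inner_sum_left orthonormal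
        inner_commute[of "v j"] if_distrib cong: if_cong)
  then have "orthogonal r r"
    using basis by (intro orthogonal_to_span[of r "range v"]) auto
  then show ?thesis by (simp add: r_def orthogonal_def)
qed

lemma orthonormal_parseval:
  fixes v :: "'d::finite \<Rightarrow> 'a::euclidean_space"
  assumes "\<And>i j. v i \<bullet> v j = (if i = j then 1 else 0)" and "span (range v) = UNIV"
  shows "y \<bullet> y = (\<Sum>i\<in>UNIV. (v i \<bullet> y)\<^sup>2)"
proof -
  have "y \<bullet> y = (\<Sum>i\<in>UNIV. (v i \<bullet> y) *\<^sub>R v i) \<bullet> y"
    by (simp only: orthonormal_expansion[OF assms])
  then show ?thesis by (simp add: inner_sum_left power2_eq_square)
qed

lemma matrix_vector_mult_eigenbasis:
  fixes C :: "real^'d^'d" and v :: "'d \<Rightarrow> real^'d"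
  assumes orthonormal: "\<And>i j. v i \<bullet> v j = (if i = j then 1 else 0)"
    and basis: "span (range v) = UNIV"
    and eigen: "\<And>i. C *v v i = lam i *s v i"
  shows "C *v y = (\<Sum>i\<in>UNIV. (lam i * (v i \<bullet> y)) *\<^sub>R v i)"
proof -
  have "C *v y = C *v (\<Sum>i\<in>UNIV. (v i \<bullet> y) *\<^sub>R v i)"
    by (simp only: orthonormal_expansion[OF orthonormal basis])
  also have "\<dots> = (\<Sum>i\<in>UNIV. (v i \<bullet> y) *\<^sub>R (C *v v i))"
    by (simp add: linear_sum[OF matrix_vector_mul_linear] matrix_vector_mult_scaleR)
  finally show ?thesis
    by (simp add: eigen scalar_mult_eq_scaleR mult.commute)
qed

lemma trace_eq_sum_eigenvalues:
  fixes C :: "real^'d^'d" and v :: "'d \<Rightarrow> real^'d"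
  assumes orthonormal: "\<And>i j. v i \<bullet> v j = (if i = j then 1 else 0)"
    and basis: "span (range v) = UNIV"
    and eigen: "\<And>i. C *v v i = lam i *s v i"
  shows "trace C = (\<Sum>i\<in>UNIV. lam i)"
proof -
  have "C $ k $ k = (\<Sum>i\<in>UNIV. lam i * (v i $ k * v i $ k))" for k
  proof -
    have "C $ k $ k = (C *v axis k 1) $ k"
      by (simp add: matrix_vector_mult_basis column_def)
    also have "\<dots> = (\<Sum>i\<in>UNIV. lam i * (v i $ k * v i $ k))"
      by (simp add: matrix_vector_mult_eigenbasis[OF orthonormal basis eigen] inner_axis
          mult.assoc)
    finally show ?thesis .
  qed
  then have "trace C = (\<Sum>k\<in>UNIV. \<Sum>i\<in>UNIV. lam i * (v i $ k * v i $ k))"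
    by (simp add: trace_def)
  also have "\<dots> = (\<Sum>i\<in>UNIV. lam i * (v i \<bullet> v i))"
    by (subst sum.swap) (simp add: inner_vec_def sum_distrib_left)
  finally show ?thesis by (simp add: orthonormal)
qed

lemma matrix_inv_eigenvector:
  fixes C :: "real^'d^'d" and v :: "'d \<Rightarrow> real^'d"
  assumes orthonormal: "\<And>i j. v i \<bullet> v j = (if i = j then 1 else 0)"
    and basis: "span (range v) = UNIV"
    and eigen: "\<And>i. C *v v i = lam i *s v i"
    and lam_nonzero: "\<And>i. lam i \<noteq> 0"
  shows "matrix_inv C *v v i = (1 / lam i) *s v i"
proof -
  have "y = 0" if "C *v y = 0" for y
  proof -
    have "lam j * (v j \<bullet> y) = v j \<bullet> (C *v y)" for j
      by (simp add: matrix_vector_mult_eigenbasis[OF orthonormal basis eigen] inner_sum_right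
          orthonormal if_distrib cong: if_cong)
    then have "v j \<bullet> y = 0" for j
      using that lam_nonzero[of j] by (metis inner_zero_right mult_eq_0_iff)
    then show ?thesis
      using orthonormal_parseval[OF orthonormal basis, of y] by simp
  qed
  then have "invertible C"
    using matrix_left_invertible_ker invertible_left_inverse by blast
  \<comment> \<open>\<^term>\<open>matrix_inv\<close> is a choice among the two-sided inverses.\<close>
  then have "matrix_inv C ** C = mat 1"
    unfolding invertible_def matrix_inv_def by (rule someI2_ex) simp
  then have "v i = matrix_inv C *v (C *v v i)"
    by (simp add: matrix_vector_mul_assoc)
  also have "\<dots> = lam i *s (matrix_inv C *v v i)"
    by (simp add: eigen scalar_mult_eq_scaleR matrix_vector_mult_scaleR)
  finally have "(1 / lam i) *s v i = (1 / lam i) *s (lam i *s (matrix_inv C *v v i))"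
    by (rule arg_cong)
  then show ?thesis
    using lam_nonzero[of i] by (simp add: vector_smult_assoc)
qed

text \<open>In the eigenbasis the quadratic form of the inverse matrix is \<open>\<Sum>\<^sub>j (v\<^sub>j \<bullet> y)\<^sup>2 / \<lambda>\<^sub>j\<close>, and a
  single summand is at most the sum.\<close>

lemma inner_eigenvector_power2_le:
  fixes C :: "real^'d^'d" and v :: "'d \<Rightarrow> real^'d"
  assumes orthonormal: "\<And>i j. v i \<bullet> v j = (if i = j then 1 else 0)"
    and basis: "span (range v) = UNIV"
    and eigen: "\<And>i. C *v v i = lam i *s v i"
    and lam_pos: "\<And>i. lam i > 0"
  shows "(v i \<bullet> y)\<^sup>2 \<le> lam i * (y \<bullet> (matrix_inv C *v y))"
proof -
  have inv_eigen: "matrix_inv C *v v j = (1 / lam j) *s v j" for j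
    using lam_pos by (intro matrix_inv_eigenvector[OF orthonormal basis eigen])
      (metis less_irrefl)
  have "(v i \<bullet> y)\<^sup>2 / lam i \<le> (\<Sum>j\<in>UNIV. (v j \<bullet> y)\<^sup>2 / lam j)"
    using lam_pos by (intro member_le_sum) (auto simp: less_imp_le)
  also have "\<dots> = y \<bullet> (matrix_inv C *v y)"
    by (simp add: matrix_vector_mult_eigenbasis[OF orthonormal basis inv_eigen] inner_sum_right
        inner_commute power2_eq_square)
  finally show ?thesis
    using lam_pos[of i] by (simp add: divide_le_eq mult.commute)
qed

lemma (in prob_space) integrable_comp_finite:
  fixes f :: "'b::finite \<Rightarrow> real"
  assumes "Z \<in> measurable M (count_space UNIV)"
  shows "integrable M (\<lambda>\<omega>. f (Z \<omega>))"
proof (rule integrable_const_bound[where B = "Max (range (\<lambda>z. \<bar>f z\<bar>))"])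
  show "(\<lambda>\<omega>. f (Z \<omega>)) \<in> borel_measurable M"
    using measurable_compose[OF assms, of f borel] by simp
qed simp

lemma (in prob_space) variance_le_second_moment_about:
  fixes X :: "'a \<Rightarrow> real"
  assumes "integrable M X" and "integrable M (\<lambda>\<omega>. (X \<omega>)\<^sup>2)"
  shows "variance X \<le> expectation (\<lambda>\<omega>. (X \<omega> - a)\<^sup>2)"
proof -
  have "expectation (\<lambda>\<omega>. (X \<omega> - a)\<^sup>2)
      = expectation (\<lambda>\<omega>. (X \<omega>)\<^sup>2) - 2 * a * expectation X + a\<^sup>2"
    using assms by (simp add: power2_diff prob_space algebra_simps)
  then have "expectation (\<lambda>\<omega>. (X \<omega> - a)\<^sup>2) - variance X = (expectation X - a)\<^sup>2"
    using assms by (simp add: variance_eq power2_diff prob_space flip: power2_eq_square)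
  then show ?thesis
    by (metis diff_ge_0_iff_ge zero_le_power2)
qed

lemma (in prob_space) expectation_le_bound_times_prob_neq:
  fixes f :: "'b::finite \<Rightarrow> real"
  assumes Z: "Z \<in> measurable M (count_space UNIV)"
    and "f z0 = 0" and "\<And>z. f z \<le> b"
  shows "expectation (\<lambda>\<omega>. f (Z \<omega>)) \<le> b * \<P>(\<omega> in M. Z \<omega> \<noteq> z0)"
proof -
  have "expectation (\<lambda>\<omega>. f (Z \<omega>)) \<le> expectation (\<lambda>\<omega>. b * of_bool (Z \<omega> \<noteq> z0))"
    using assms
    by (intro integral_mono integrable_comp_finite[OF Z]
        integrable_comp_finite[OF Z, of "\<lambda>z. b * of_bool (z \<noteq> z0)"]) auto
  also have "\<dots> = b * expectation (\<lambda>\<omega>. indicator {\<omega> \<in> space M. Z \<omega> \<noteq> z0} \<omega>)"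
    by (subst integral_mult_right_zero, intro arg_cong2[where f = "(*)"] refl
        Bochner_Integration.integral_cong) (auto simp: indicator_def)
  also have "\<dots> = b * \<P>(\<omega> in M. Z \<omega> \<noteq> z0)"
    by (simp add: Int_absorb2)
  finally show ?thesis .
qed

theorem theorem5p1:
  fixes A :: "real^'n^'m" and g :: "real^'m" and \<Phi> :: "real^'d^'n" and \<alpha> :: real
    and B :: "real^'N^'d" and c :: real and E :: "bool^'N \<Rightarrow> real"
    and zstar :: "bool^'N"
    and v :: "'d \<Rightarrow> real^'d" and lam :: "'d \<Rightarrow> real"
    and \<gamma> T K Emax :: real
    and \<psi> :: "real \<Rightarrow> complex^(bool^'N)"
    and M :: "'w measure" and z_T :: "'w \<Rightarrow> bool^'N" and x_T :: "'w \<Rightarrow> real^'d"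
    and S_T :: "'d \<Rightarrow> 'w \<Rightarrow> real"
  assumes alpha_pos: "\<alpha> > 0"
    and E_eq: "E = energy A g \<Phi> \<alpha> B c"
    and representable: "encode B zstar = x_MAP A g \<Phi> \<alpha>"
    and eigen: "\<And>i. C_post A \<Phi> \<alpha> *v v i = lam i *s v i"
    and orthonormal: "\<And>i j. v i \<bullet> v j = (if i = j then 1 else 0)"
    and basis: "span (range v) = UNIV"
    and lam_pos: "\<And>i. lam i > 0"
    and simple: "\<And>s. s \<in> {0..1} \<Longrightarrow> simple_ground (Ham E s)"
    and gap: "is_minimal_gap E \<gamma>" and gamma_pos: "\<gamma> > 0"
    and T_pos: "T > 0"
    and evolution: "adiabatic_evolution E T \<psi>"
    and prob: "prob_space M"
    and z_T_rv: "z_T \<in> measurable M (count_space UNIV)"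
    and z_T_law: "\<And>z. \<P>(\<omega> in M. z_T \<omega> = z) = born_prob (\<psi> 1) z"
    and x_T_eq: "\<And>\<omega>. x_T \<omega> = encode B (z_T \<omega>)"
    and S_T_eq: "\<And>i \<omega>. S_T i \<omega> = v i \<bullet> (x_T \<omega> - x_MAP A g \<Phi> \<alpha>)"
    and K_pos: "K > 0"
    and failure: "\<P>(\<omega> in M. z_T \<omega> \<noteq> zstar) \<le> K / (T\<^sup>2 * \<gamma> ^ 4)"
    and excess: "\<And>z. E z - E zstar \<le> Emax"
  shows "(\<forall>i. prob_space.variance M (S_T i) \<le> (2 * Emax * K) * (lam i / (T\<^sup>2 * \<gamma> ^ 4))) \<and>
         trace (covariance_matrix M x_T)
           \<le> (2 * Emax * K) * (trace (C_post A \<Phi> \<alpha>) / (T\<^sup>2 * \<gamma> ^ 4))"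
proof -
  interpret prob_space M by (rule prob)
  define p where "p = \<P>(\<omega> in M. z_T \<omega> \<noteq> zstar)"
  define y where "y z = encode B z - x_MAP A g \<Phi> \<alpha>" for z
  note basis_facts = orthonormal basis
  have Emax_nonneg: "0 \<le> Emax" using excess[of zstar] by simp
  have "y zstar = 0" by (simp add: y_def representable)
  \<comment> \<open>At \<open>z\<^sup>\<star>\<close> the energy reduces to its additive constant, which cancels in the excess.\<close>
  have quadratic_le: "y z \<bullet> (matrix_inv (C_post A \<Phi> \<alpha>) *v y z) \<le> 2 * Emax" for z
    using excess[of z] \<open>y zstar = 0\<close> by (simp add: E_eq energy_def flip: y_def)
  have coord_le: "(v i \<bullet> y z)\<^sup>2 \<le> 2 * Emax * lam i" for i z
  proof -
    have "(v i \<bullet> y z)\<^sup>2 \<le> lam i * (y z \<bullet> (matrix_inv (C_post A \<Phi> \<alpha>) *v y z))"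
      by (rule inner_eigenvector_power2_le[OF basis_facts eigen lam_pos])
    also have "\<dots> \<le> lam i * (2 * Emax)"
      using quadratic_le lam_pos[of i] by (intro mult_left_mono) auto
    finally show ?thesis by (simp add: mult.commute)
  qed
  have moment_le: "expectation (\<lambda>\<omega>. (v i \<bullet> y (z_T \<omega>))\<^sup>2)
      \<le> (2 * Emax * K) * (lam i / (T\<^sup>2 * \<gamma> ^ 4))" for i
  proof -
    have "expectation (\<lambda>\<omega>. (v i \<bullet> y (z_T \<omega>))\<^sup>2) \<le> 2 * Emax * lam i * p"
      unfolding p_def using coord_le \<open>y zstar = 0\<close>
      by (intro expectation_le_bound_times_prob_neq[OF z_T_rv]) auto
    also have "\<dots> \<le> 2 * Emax * lam i * (K / (T\<^sup>2 * \<gamma> ^ 4))"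
      using failure Emax_nonneg lam_pos[of i] by (intro mult_left_mono) (auto simp: p_def)
    finally show ?thesis by (simp add: mult_ac)
  qed
  have variance_le: "variance (\<lambda>\<omega>. f (z_T \<omega>)) \<le> expectation (\<lambda>\<omega>. (f (z_T \<omega>) - a)\<^sup>2)"
    for f :: "bool^'N \<Rightarrow> real" and a
    by (intro variance_le_second_moment_about integrable_comp_finite[OF z_T_rv]
        integrable_comp_finite[OF z_T_rv, of "\<lambda>z. (f z)\<^sup>2"])
  have "variance (S_T i) \<le> (2 * Emax * K) * (lam i / (T\<^sup>2 * \<gamma> ^ 4))" for i
  proof -
    have "S_T i = (\<lambda>\<omega>. v i \<bullet> y (z_T \<omega>))"
      by (simp add: fun_eq_iff S_T_eq x_T_eq y_def)
    then show ?thesis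
      using variance_le[of "\<lambda>z. v i \<bullet> y z" 0] moment_le[of i] by simp
  qed
  moreover have "trace (covariance_matrix M x_T)
      \<le> (2 * Emax * K) * (trace (C_post A \<Phi> \<alpha>) / (T\<^sup>2 * \<gamma> ^ 4))"
  proof -
    have "trace (covariance_matrix M x_T)
        = (\<Sum>j\<in>UNIV. variance (\<lambda>\<omega>. encode B (z_T \<omega>) $ j))"
      by (simp add: trace_def covariance_matrix_def x_T_eq power2_eq_square)
    \<comment> \<open>Each variance is compared with the second moment about the posterior mode.\<close>
    also have "\<dots> \<le> (\<Sum>j\<in>UNIV. expectation (\<lambda>\<omega>. (y (z_T \<omega>) $ j)\<^sup>2))"
      unfolding y_def vector_minus_component
      by (intro sum_mono variance_le[of "\<lambda>z. encode B z $ _"])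
    also have "\<dots> = expectation (\<lambda>\<omega>. y (z_T \<omega>) \<bullet> y (z_T \<omega>))"
      by (subst Bochner_Integration.integral_sum[symmetric])
        (auto simp: inner_vec_def power2_eq_square intro: integrable_comp_finite[OF z_T_rv])
    also have "\<dots> = (\<Sum>i\<in>UNIV. expectation (\<lambda>\<omega>. (v i \<bullet> y (z_T \<omega>))\<^sup>2))"
      unfolding orthonormal_parseval[OF basis_facts]
      by (intro Bochner_Integration.integral_sum
          integrable_comp_finite[OF z_T_rv, of "\<lambda>z. (v _ \<bullet> y z)\<^sup>2"])
    also have "\<dots> \<le> (\<Sum>i\<in>UNIV. (2 * Emax * K) * (lam i / (T\<^sup>2 * \<gamma> ^ 4)))"
      by (intro sum_mono moment_le)
    also have "\<dots> = (2 * Emax * K) * (trace (C_post A \<Phi> \<alpha>) / (T\<^sup>2 * \<gamma> ^ 4))"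
      by (simp add: trace_eq_sum_eigenvalues[OF basis_facts eigen] sum_distrib_left
          sum_divide_distrib)
    finally show ?thesis .
  qed
  ultimately show ?thesis by blast
qed

end
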